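(* Let $f:\mathbb{R}^d\to\mathbb{R}$ be a differentiable convex function with unique minimizer $x^\star$, and suppose that for some $\alpha>0$ it satisfies the $\alpha$-quadratic growth condition $f(x)\ge f(x^\star)+\frac{\alpha}{2}\|x-x^\star\|^2$ for all $x\in\mathbb{R}^d$. Let $C>0$, let $K\ge 1$ be an integer, let $X_0\in\mathbb{R}^d$, and let $T\ge \frac{C}{\sqrt{\alpha}}$. Let $X_K$ be the output of the algorithm HFA run from $X_0$ for $K$ iterations with parameter $\lambda=0$ and integration times $T_k=T$ for all $k\in\{1,\dots,K\}$. Then $$f(X_K)-f(x^\star)\le\left(\frac{2}{3}+\frac{2}{3C^2}\right)^K\,(f(X_0)-f(x^\star)).$$
   Context: The Hamiltonian flow of $f$ is the system $\dot X_t=Y_t$, $\dot Y_t=-\nabla f(X_t)$ on $\mathbb{R}^d\times\mathbb{R}^d$. Standing assumption: for every initial condition it admits a unique solution on $[0,\infty)$. Algorithm HFA (Hamiltonian Flow for optimization with Averaging). Input: $X_0\in\mathbb{R}^d$, number of iterations $K\in\mathbb{N}$, parameter $\lambda\ge0$, integration times $T_1,\dots,T_K>0$. For $k=1,\dots,K$: let $(X^{(k)}_t,Y^{(k)}_t)_{t\in[0,T_k]}$ be the Hamiltonian flow with initial condition $(X^{(k)}_0,Y^{(k)}_0)=(X_{k-1},\mathbf{0})$; compute $X^{\mathrm{avg}}(X_{k-1};T_k)=\frac{2}{T_k^2}\int_0^{T_k}(T_k-t)X^{(k)}_t\,\mathrm{d}t$; set $X_k=\frac{1}{\lambda+1}X^{\mathrm{avg}}(X_{k-1};T_k)+\frac{\lambda}{\lambda+1}X^{(k)}_{T_k}$.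 Output: $X_K$. *)

theory Defs
  imports "HOL-Analysis.Analysis"
begin

definition grad :: "('a::euclidean_space \<Rightarrow> real) \<Rightarrow> 'a \<Rightarrow> 'a" where
  "grad f x = (THE D. GDERIV f x :> D)"

text \<open>A phase-space trajectory is a map \<open>Z :: real \<Rightarrow> 'a \<times> 'a\<close> with \<open>Z t = (X t, Y t)\<close>.  Only its values
  at times \<open>t \<ge> 0\<close> matter; at \<open>t = 0\<close> the derivative is one-sided.\<close>

definition hamiltonian_solution ::
    "('a::euclidean_space \<Rightarrow> real) \<Rightarrow> 'a \<times> 'a \<Rightarrow> (real \<Rightarrow> 'a \<times> 'a) \<Rightarrow> bool" where
  "hamiltonian_solution f z Z \<longleftrightarrow>
     Z 0 = z \<and>
     (\<forall>t\<ge>0. (Z has_vector_derivative (snd (Z t), - grad f (fst (Z t)))) (at t within {0..}))"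

text \<open>Solutions are total functions on the reals, so uniqueness means agreement on \<open>{0..}\<close>
  rather than equality of functions.\<close>

definition hamiltonian_well_posed :: "('a::euclidean_space \<Rightarrow> real) \<Rightarrow> bool" where
  "hamiltonian_well_posed f \<longleftrightarrow>
     (\<forall>z. \<exists>Z. hamiltonian_solution f z Z \<and>
              (\<forall>Z'. hamiltonian_solution f z Z' \<longrightarrow> (\<forall>t\<ge>0. Z' t = Z t)))"

text \<open>For well-posed \<open>f\<close>, the values of the flow at \<open>t \<ge> 0\<close> do not depend on the choice made by
  \<open>SOME\<close>.\<close>

definition hamiltonian_flow ::
    "('a::euclidean_space \<Rightarrow> real) \<Rightarrow> 'a \<times> 'a \<Rightarrow> real \<Rightarrow> 'a \<times> 'a" where
  "hamiltonian_flow f z = (SOME Z. hamiltonian_solution f z Z)"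

definition flow_avg :: "('a::euclidean_space \<Rightarrow> real) \<Rightarrow> 'a \<Rightarrow> real \<Rightarrow> 'a" where
  "flow_avg f x T =
     (2 / T\<^sup>2) *\<^sub>R integral {0..T} (\<lambda>t. (T - t) *\<^sub>R fst (hamiltonian_flow f (x, 0) t))"

definition hfa_step :: "('a::euclidean_space \<Rightarrow> real) \<Rightarrow> real \<Rightarrow> real \<Rightarrow> 'a \<Rightarrow> 'a" where
  "hfa_step f lam T x =
     (1 / (lam + 1)) *\<^sub>R flow_avg f x T +
     (lam / (lam + 1)) *\<^sub>R fst (hamiltonian_flow f (x, 0) T)"

text \<open>\<open>hfa f lam T x0 k\<close> is the \<open>k\<close>-th iterate \<open>X\<^sub>k\<close>, so the output after \<open>K\<close> iterations is
  \<open>hfa f lam T x0 K\<close>.  The integration times are \<open>T 1, \<dots>, T K\<close>; \<open>T 0\<close> is never used.\<close>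

primrec hfa ::
    "('a::euclidean_space \<Rightarrow> real) \<Rightarrow> real \<Rightarrow> (nat \<Rightarrow> real) \<Rightarrow> 'a \<Rightarrow> nat \<Rightarrow> 'a" where
  "hfa f lam T x0 0 = x0"
| "hfa f lam T x0 (Suc k) = hfa_step f lam (T (Suc k)) (hfa f lam T x0 k)"

end

theory Submission
  imports Defs
begin

text \<open>
  Fix one run of the flow, \<open>X\<close> with velocity \<open>Y\<close>, started at rest at \<open>x\<close>, and put
  \<open>g t = \<parallel>X t - c\<parallel>\<^sup>2 / 2\<close> for a reference point \<open>c\<close>, later the minimizer. The flow gives
  \<open>g'' = \<parallel>Y\<parallel>\<^sup>2 - \<langle>\<nabla>f X, X - c\<rangle>\<close>. Conservation of the energy \<open>f X + \<parallel>Y\<parallel>\<^sup>2 / 2\<close>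
  (\<open>hamiltonian_energy_conserved\<close>) turns the kinetic term into \<open>2 (f x - f X)\<close>, and convexity
  (\<open>convex_above_tangent_plane\<close>) bounds the other term by \<open>f c - f X\<close>, so that
  \<open>3 (f X - f c) \<le> 2 (f x - f c) - g''\<close>.

  The weight \<open>T - t\<close> of the average is exactly the one that integrates \<open>g''\<close> twice:
  \<open>\<integral> (T - t) g'' dt = g T - g 0\<close>, because \<open>g' 0 = 0\<close> for a start at rest. Hence the weighted
  mean of \<open>f X - f c\<close> is at most \<open>2/3 (f x - f c) + 2 (g 0 - g T) / (3 T\<^sup>2)\<close>, where \<open>- g T\<close>
  may be dropped, and by Jensen's inequality the same bound holds for the value of \<open>f\<close> at the
  averaged point. This is \<open>flow_avg_gap\<close>, valid for every \<open>c\<close>.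

  With \<open>c\<close> the minimizer, quadratic growth gives \<open>g 0 \<le> (f x - f c) / \<alpha>\<close>, and
  \<open>\<alpha> T\<^sup>2 \<ge> C\<^sup>2\<close> makes the bound a contraction estimate for one step
  (\<open>flow_avg_contraction\<close>); iterating it yields the theorem.
\<close>

section \<open>Gradients and convexity\<close>

lemma has_gradient_grad:
  fixes f :: "'a::euclidean_space \<Rightarrow> real"
  assumes "f differentiable at x"
  shows "GDERIV f x :> grad f x"
proof -
  obtain L where L: "(f has_derivative L) (at x)"
    using assms unfolding differentiable_def by blast
  then have lin: "linear L"
    by (rule has_derivative_linear)
  have "L h = inner h (adjoint L 1)" for h
    using adjoint_works[OF lin, of h 1] by simp
  with L have G: "GDERIV f x :> adjoint L 1"
    unfolding gderiv_def by (metis ext)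
  have "D = adjoint L 1" if "GDERIV f x :> D" for D
  proof -
    have "(\<lambda>h. inner h D) = (\<lambda>h. inner h (adjoint L 1))"
      using that G unfolding gderiv_def by (rule has_derivative_unique)
    then show ?thesis
      by (metis inner_commute vector_eq_ldot)
  qed
  with G show ?thesis
    unfolding grad_def by (rule theI)
qed

text \<open>Restricting \<open>f\<close> to the line through \<open>x\<close> and \<open>y\<close> reduces the claim to the tangent
  inequality for convex functions of one real variable.\<close>

lemma convex_above_tangent_plane:
  fixes f :: "'a::euclidean_space \<Rightarrow> real"
  assumes cvx: "convex_on UNIV f" and diff: "f differentiable at x"
  shows "f x + inner (grad f x) (y - x) \<le> f y"
proof -
  define \<phi> where "\<phi> s = f (x + s *\<^sub>R (y - x))" for s :: real
  have cvx': "convex_on UNIV \<phi>"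
  proof (rule convex_onI)
    fix t u v :: real
    assume t: "0 < t" "t < 1"
    have "x + ((1 - t) *\<^sub>R u + t *\<^sub>R v) *\<^sub>R (y - x)
        = (1 - t) *\<^sub>R (x + u *\<^sub>R (y - x)) + t *\<^sub>R (x + v *\<^sub>R (y - x))"
      by (simp add: algebra_simps)
    then show "\<phi> ((1 - t) *\<^sub>R u + t *\<^sub>R v) \<le> (1 - t) * \<phi> u + t * \<phi> v"
      unfolding \<phi>_def using convex_onD[OF cvx, of t] t by simp
  qed simp
  have line: "((\<lambda>s. x + s *\<^sub>R (y - x)) has_derivative (\<lambda>s. s *\<^sub>R (y - x))) (at (0::real))"
    by (auto intro!: derivative_eq_intros)
  have "(f has_derivative (\<lambda>h. inner h (grad f x))) (at (x + 0 *\<^sub>R (y - x)))"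
    using has_gradient_grad[OF diff] by (simp add: gderiv_def)
  from has_derivative_compose[OF line this]
  have "(\<phi> has_real_derivative inner (grad f x) (y - x)) (at 0)"
    unfolding \<phi>_def has_field_derivative_def
    by (simp add: inner_commute mult_commute_abs)
  from convex_on_imp_above_tangent[OF cvx' _ _ _ this, of 1]
  show ?thesis
    unfolding \<phi>_def by simp
qed

section \<open>Solutions of the Hamiltonian system\<close>

lemma hamiltonian_flow_solution:
  assumes "hamiltonian_well_posed f"
  shows "hamiltonian_solution f z (hamiltonian_flow f z)"
  using assms unfolding hamiltonian_well_posed_def hamiltonian_flow_def
  by (metis someI_ex)

lemma hamiltonian_solution_derivatives:
  assumes "hamiltonian_solution f z Z" and "t \<ge> 0"
  shows "((\<lambda>t. fst (Z t)) has_vector_derivative snd (Z t)) (at t within {0..})"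
    and "((\<lambda>t. snd (Z t)) has_vector_derivative - grad f (fst (Z t))) (at t within {0..})"
proof -
  have "(Z has_vector_derivative (snd (Z t), - grad f (fst (Z t)))) (at t within {0..})"
    using assms unfolding hamiltonian_solution_def by blast
  from has_derivative_fst[OF this[unfolded has_vector_derivative_def]]
    has_derivative_snd[OF this[unfolded has_vector_derivative_def]]
  show "((\<lambda>t. fst (Z t)) has_vector_derivative snd (Z t)) (at t within {0..})"
    and "((\<lambda>t. snd (Z t)) has_vector_derivative - grad f (fst (Z t))) (at t within {0..})"
    by (simp_all add: has_vector_derivative_def)
qed

text \<open>The chain rule contributes \<open>\<langle>\<nabla>f X, Y\<rangle>\<close> to the derivative of the energy from the potential
  and \<open>\<langle>Y, - \<nabla>f X\<rangle>\<close> from the kinetic part, and these cancel.\<close>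

lemma hamiltonian_energy_conserved:
  fixes f :: "'a::euclidean_space \<Rightarrow> real"
  assumes sol: "hamiltonian_solution f z Z"
    and diff: "\<And>x. f differentiable at x"
    and "t \<ge> 0"
  shows "f (fst (Z t)) + (norm (snd (Z t)))\<^sup>2 / 2 = f (fst z) + (norm (snd z))\<^sup>2 / 2"
proof -
  define E where "E t = f (fst (Z t)) + inner (snd (Z t)) (snd (Z t)) / 2" for t
  have "(E has_derivative (\<lambda>h. 0)) (at s within {0..})" if "s \<in> {0..}" for s
  proof -
    have s: "s \<ge> 0" using that by simp
    note X = hamiltonian_solution_derivatives(1)[OF sol s, unfolded has_vector_derivative_def]
    note Y = hamiltonian_solution_derivatives(2)[OF sol s, unfolded has_vector_derivative_def]
    have "(f has_derivative (\<lambda>h. inner h (grad f (fst (Z s))))) (at (fst (Z s)))"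
      using has_gradient_grad[OF diff] by (simp add: gderiv_def)
    from has_derivative_compose[OF X this]
    have fX: "((\<lambda>t. f (fst (Z t))) has_derivative
        (\<lambda>h. inner (h *\<^sub>R snd (Z s)) (grad f (fst (Z s))))) (at s within {0..})" .
    show ?thesis
      unfolding E_def
      by (rule derivative_eq_intros fX Y)+
         (auto simp: inner_commute algebra_simps)
  qed
  moreover have "convex {0::real..}" by simp
  ultimately obtain c where "\<forall>s\<in>{0..}. E s = c"
    using has_derivative_zero_constant[of "{0::real..}" E] by blast
  then have "E t = E 0" using \<open>t \<ge> 0\<close> by simp
  moreover have "Z 0 = z" using sol by (simp add: hamiltonian_solution_def)
  ultimately show ?thesis
    by (simp add: E_def power2_norm_eq_inner)
qed

section \<open>The averaged point\<close>

lemma has_integral_triangular_weight: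
  fixes T :: real
  assumes "T \<ge> 0"
  shows "((\<lambda>t. T - t) has_integral T\<^sup>2 / 2) {0..T}"
proof -
  have "((\<lambda>t. T - t) has_integral (- (T - T)\<^sup>2 / 2 - - (T - 0)\<^sup>2 / 2)) {0..T}"
    by (rule fundamental_theorem_of_calculus[OF assms])
       (auto intro!: derivative_eq_intros
          simp: has_real_derivative_iff_has_vector_derivative[symmetric] field_simps)
  then show ?thesis by simp
qed

text \<open>The weight \<open>T - t\<close> has total mass \<open>T\<^sup>2 / 2\<close>, so \<open>flow_avg\<close> is the barycentre of the
  trajectory. In this form the linear term of a tangent plane at the barycentre integrates
  to \<open>0\<close>, which is how Jensen's inequality enters below.\<close>

lemma has_integral_flow_avg:
  fixes f :: "'a::euclidean_space \<Rightarrow> real"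
  assumes "hamiltonian_well_posed f" and "T > 0"
  shows "((\<lambda>t. (T - t) *\<^sub>R (fst (hamiltonian_flow f (x, 0) t) - flow_avg f x T))
          has_integral 0) {0..T}"
proof -
  define X where "X t = fst (hamiltonian_flow f (x, 0) t)" for t
  have "(X has_vector_derivative snd (hamiltonian_flow f (x, 0) t)) (at t within {0..})"
    if "t \<ge> 0" for t
    unfolding X_def
    by (rule hamiltonian_solution_derivatives(1)[OF hamiltonian_flow_solution[OF assms(1)] that])
  then have "continuous_on {0..} X"
    by (meson atLeast_iff has_vector_derivative_continuous continuous_on_eq_continuous_within)
  then have "continuous_on {0..T} X"
    by (rule continuous_on_subset) auto
  then have "(\<lambda>t. (T - t) *\<^sub>R X t) integrable_on {0..T}"
    by (intro integrable_continuous_interval continuous_intros)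
  then have I: "((\<lambda>t. (T - t) *\<^sub>R X t) has_integral integral {0..T} (\<lambda>t. (T - t) *\<^sub>R X t)) {0..T}"
    by (rule integrable_integral)
  have "((\<lambda>t. (T - t) *\<^sub>R flow_avg f x T) has_integral (T\<^sup>2 / 2) *\<^sub>R flow_avg f x T) {0..T}"
    using has_integral_triangular_weight[of T] \<open>T > 0\<close>
    by (intro has_integral_scaleR_left) auto
  from has_integral_diff[OF I this]
  have "((\<lambda>t. (T - t) *\<^sub>R (X t - flow_avg f x T)) has_integral
      integral {0..T} (\<lambda>t. (T - t) *\<^sub>R X t) - (T\<^sup>2 / 2) *\<^sub>R flow_avg f x T) {0..T}"
    by (simp only: scaleR_diff_right)
  moreover have "(T\<^sup>2 / 2) *\<^sub>R flow_avg f x T = integral {0..T} (\<lambda>t. (T - t) *\<^sub>R X t)"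
    using \<open>T > 0\<close> by (simp add: flow_avg_def X_def)
  ultimately show ?thesis
    by (simp add: X_def)
qed

text \<open>Jensen's inequality is not applied as a separate step: the tangent plane of \<open>f\<close> at the
  average is inserted into the pointwise inequality before integrating. Every integrand is then
  either the derivative of a known primitive or linear in the trajectory, hence integrable
  without an appeal to continuity of the gradient.\<close>

lemma flow_avg_gap:
  fixes f :: "'a::euclidean_space \<Rightarrow> real"
  assumes diff: "\<And>x. f differentiable at x"
    and cvx: "convex_on UNIV f"
    and wp: "hamiltonian_well_posed f"
    and T: "T > 0"
  shows "f (flow_avg f x T) - f c
       \<le> 2 / 3 * (f x - f c) + (norm (x - c))\<^sup>2 / (3 * T\<^sup>2)"
proof -
  define Z where "Z = hamiltonian_flow f (x, 0)"
  define X where "X t = fst (Z t)" for t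
  define Y where "Y t = snd (Z t)" for t
  define a where "a = flow_avg f x T"
  define g where "g t = inner (X t - c) (X t - c) / 2" for t
  define g' where "g' t = inner (X t - c) (Y t)" for t
  define g'' where "g'' t = inner (Y t) (Y t) - inner (X t - c) (grad f (X t))" for t
  have sol: "hamiltonian_solution f (x, 0) Z"
    unfolding Z_def by (rule hamiltonian_flow_solution[OF wp])
  have Z0: "X 0 = x" "Y 0 = 0"
    using sol by (simp_all add: hamiltonian_solution_def X_def Y_def)

  have primitive: "((\<lambda>t. (T - t) * g' t + g t) has_vector_derivative (T - t) * g'' t)
      (at t within {0..T})" if "t \<in> {0..T}" for t
  proof -
    have t: "t \<ge> 0" and sub: "{0..T} \<subseteq> {0..}" using that by auto
    note dX = has_vector_derivative_within_subset
      [OF hamiltonian_solution_derivatives(1)[OF sol t] sub, folded X_def Y_def,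
       unfolded has_vector_derivative_def]
    note dY = has_vector_derivative_within_subset
      [OF hamiltonian_solution_derivatives(2)[OF sol t] sub, folded X_def Y_def,
       unfolded has_vector_derivative_def]
    have dg: "(g has_derivative (\<lambda>h. h * g' t)) (at t within {0..T})"
      unfolding g_def g'_def
      by (rule derivative_eq_intros dX refl)+
         (auto simp: fun_eq_iff inner_commute field_simps)
    have dg': "(g' has_derivative (\<lambda>h. h * g'' t)) (at t within {0..T})"
      unfolding g'_def g''_def
      by (rule derivative_eq_intros dX dY refl)+
         (auto simp: fun_eq_iff inner_commute algebra_simps)
    show ?thesis
      unfolding has_vector_derivative_def
      by (rule derivative_eq_intros dg dg' refl)+
         (auto simp: fun_eq_iff algebra_simps)
  qed
  \<comment> \<open>At \<open>t = 0\<close> the primitive is only \<open>g 0\<close>, because the flow starts at rest.\<close>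
  have virial: "((\<lambda>t. (T - t) * g'' t) has_integral g T - g 0) {0..T}"
    using fundamental_theorem_of_calculus[OF _ primitive] T
    by (simp add: g'_def Z0)

  have centred: "((\<lambda>t. inner (grad f a) ((T - t) *\<^sub>R (X t - a))) has_integral 0) {0..T}"
    using has_integral_linear[OF has_integral_flow_avg[OF wp T, of x]
        bounded_linear_inner_right[of "grad f a"]]
    by (simp add: o_def X_def Z_def a_def)

  have pointwise: "3 * (f a - f c) \<le> 2 * (f x - f c) - g'' t - 3 * inner (grad f a) (X t - a)"
    if "t \<ge> 0" for t
  proof -
    have "f (X t) + inner (Y t) (Y t) / 2 = f x"
      using hamiltonian_energy_conserved[OF sol diff that]
      by (simp add: X_def Y_def power2_norm_eq_inner)
    moreover have "f (X t) + inner (grad f (X t)) (c - X t) \<le> f c"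
      by (rule convex_above_tangent_plane[OF cvx diff])
    moreover have "f a + inner (grad f a) (X t - a) \<le> f (X t)"
      by (rule convex_above_tangent_plane[OF cvx diff])
    ultimately show ?thesis
      unfolding g''_def by (simp add: inner_commute inner_diff_left inner_diff_right)
  qed

  have "((\<lambda>t. (T - t) * (3 * (f a - f c))) has_integral (T\<^sup>2 / 2) * (3 * (f a - f c))) {0..T}"
    using T by (intro has_integral_mult_left has_integral_triangular_weight) simp
  moreover have "((\<lambda>t. (T - t) * (2 * (f x - f c)) - (T - t) * g'' t
        - 3 * inner (grad f a) ((T - t) *\<^sub>R (X t - a)))
      has_integral (T\<^sup>2 / 2) * (2 * (f x - f c)) - (g T - g 0) - 3 * 0) {0..T}"
    using T by (intro has_integral_diff has_integral_mult_left has_integral_mult_right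
        has_integral_triangular_weight virial centred) simp
  \<comment> \<open>Integrate \<open>pointwise\<close> against the nonnegative weight \<open>T - t\<close>.\<close>
  ultimately have "(T\<^sup>2 / 2) * (3 * (f a - f c))
      \<le> (T\<^sup>2 / 2) * (2 * (f x - f c)) - (g T - g 0) - 3 * 0"
  proof (rule has_integral_le)
    fix t assume "t \<in> {0..T}"
    then have "(T - t) * (3 * (f a - f c))
        \<le> (T - t) * (2 * (f x - f c) - g'' t - 3 * inner (grad f a) (X t - a))"
      using pointwise by (intro mult_left_mono) auto
    then show "(T - t) * (3 * (f a - f c))
        \<le> (T - t) * (2 * (f x - f c)) - (T - t) * g'' t
          - 3 * inner (grad f a) ((T - t) *\<^sub>R (X t - a))"
      by (simp add: right_diff_distrib)
  qed
  moreover have "g T \<ge> 0" "g 0 = (norm (x - c))\<^sup>2 / 2"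
    by (simp_all add: g_def Z0 power2_norm_eq_inner)
  ultimately have "(f a - f c) * (3 * T\<^sup>2) \<le> (f x - f c) * (2 * T\<^sup>2) + (norm (x - c))\<^sup>2"
    by (simp add: algebra_simps)
  then show ?thesis
    using T unfolding a_def[symmetric] by (simp add: field_simps)
qed

section \<open>Linear convergence\<close>

text \<open>Quadratic growth bounds the squared distance to the minimizer by \<open>2 (f x - f xstar) / \<alpha>\<close>;
  the lower bound on \<open>T\<close> then makes the distance term of \<open>flow_avg_gap\<close> at most
  \<open>2 / (3 C\<^sup>2)\<close> times the current gap.\<close>

lemma flow_avg_contraction:
  fixes f :: "'a::euclidean_space \<Rightarrow> real"
  assumes diff: "\<And>x. f differentiable at x"
    and cvx: "convex_on UNIV f"
    and wp: "hamiltonian_well_posed f"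
    and \<alpha>: "\<alpha> > 0"
    and growth: "\<And>x. f x \<ge> f xstar + \<alpha> / 2 * (norm (x - xstar))\<^sup>2"
    and C: "C > 0"
    and T: "T \<ge> C / sqrt \<alpha>"
  shows "f (flow_avg f x T) - f xstar \<le> (2 / 3 + 2 / (3 * C\<^sup>2)) * (f x - f xstar)"
proof -
  have "0 < C / sqrt \<alpha>"
    using C \<alpha> by simp
  then have T0: "T > 0"
    using T by linarith
  have "(C / sqrt \<alpha>)\<^sup>2 \<le> T\<^sup>2"
    using T C \<alpha> by (intro power_mono) auto
  then have CT: "C\<^sup>2 \<le> \<alpha> * T\<^sup>2"
    using \<alpha> by (simp add: power_divide field_simps)
  have D: "(norm (x - xstar))\<^sup>2 * \<alpha> \<le> 2 * (f x - f xstar)"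
    using growth[of x] by (simp add: algebra_simps)
  have "(norm (x - xstar))\<^sup>2 * C\<^sup>2 \<le> (norm (x - xstar))\<^sup>2 * (\<alpha> * T\<^sup>2)"
    using CT by (intro mult_left_mono) auto
  also have "\<dots> \<le> 2 * (f x - f xstar) * T\<^sup>2"
    using mult_right_mono[OF D, of "T\<^sup>2"] by (simp add: mult.assoc)
  finally have "(norm (x - xstar))\<^sup>2 / (3 * T\<^sup>2) \<le> 2 / (3 * C\<^sup>2) * (f x - f xstar)"
    using T0 C by (simp add: field_simps)
  then show ?thesis
    using flow_avg_gap[OF diff cvx wp T0, of x xstar] by (simp add: distrib_right)
qed

theorem theorem1:
  fixes f :: "real ^ 'd \<Rightarrow> real"
    and xstar X0 :: "real ^ 'd"
    and \<alpha> C T :: real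
    and K :: nat
  assumes differentiable: "f differentiable_on UNIV"
    and convex: "convex_on UNIV f"
    and well_posed: "hamiltonian_well_posed f"
    and unique_minimizer: "\<And>x. is_arg_min f (\<lambda>_. True) x \<longleftrightarrow> x = xstar"
    and alpha_pos: "\<alpha> > 0"
    and quadratic_growth: "\<And>x. f x \<ge> f xstar + \<alpha> / 2 * (norm (x - xstar))\<^sup>2"
    and C_pos: "C > 0"
    and K_ge: "K \<ge> 1"
    and T_ge: "T \<ge> C / sqrt \<alpha>"
  shows "f (hfa f 0 (\<lambda>_. T) X0 K) - f xstar
           \<le> (2 / 3 + 2 / (3 * C\<^sup>2)) ^ K * (f X0 - f xstar)"
proof -
  have diff: "f differentiable at x" for x
    using differentiable by (simp add: differentiable_on_def)
  let ?q = "2 / 3 + 2 / (3 * C\<^sup>2)"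
  have "f (hfa f 0 (\<lambda>_. T) X0 k) - f xstar \<le> ?q ^ k * (f X0 - f xstar)" for k
  proof (induction k)
    case 0
    show ?case by simp
  next
    case (Suc k)
    let ?x = "hfa f 0 (\<lambda>_. T) X0 k"
    have "f (hfa f 0 (\<lambda>_. T) X0 (Suc k)) - f xstar = f (flow_avg f ?x T) - f xstar"
      by (simp add: hfa_step_def)
    also have "\<dots> \<le> ?q * (f ?x - f xstar)"
      by (rule flow_avg_contraction[OF diff convex well_posed alpha_pos quadratic_growth C_pos T_ge])
    also have "\<dots> \<le> ?q * (?q ^ k * (f X0 - f xstar))"
      using Suc.IH by (intro mult_left_mono) auto
    finally show ?case
      by (simp add: mult.assoc)
  qed
  then show ?thesis .
qed

end
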